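(* Let $\mathbf{a}=(a_1,\dots,a_n)$ be a fixed vector of integers with $0\le a_1\le\dots\le a_n$ and $a_j\ge 1$ for some $j$. Consider the family of mixed function germs $$\Gamma_{\mathbf{a}}=\Big\{f_{\mathbf{a},\mathbf{b}}=\sum_{i=1}^n z_i^{a_i+b_i}\overline{z}_i^{\,b_i}:(\mathbb{C}^n,0)\to(\mathbb{C},0)\;:\; b_1,\dots,b_n\in\mathbb{N}\Big\}.$$ There exist subfamilies of $\Gamma_{\mathbf{a}}$ that are topologically trivial and contain infinitely many distinct Lipschitz classes; that is, there exists a subset of $\Gamma_{\mathbf{a}}$ whose members are pairwise topologically equivalent and which contains infinitely many members that are pairwise not bi-Lipschitz equivalent.
   Context: Germs are regarded as real analytic map germs $(\mathbb{R}^{2n},0)\to(\mathbb{R}^2,0)$; in $\Gamma_{\mathbf{a}}$ only exponents with $f_{\mathbf{a},\mathbf{b}}(0)=0$ are considered (so $b_i\ge 1$ if $a_i=0$). Two smooth map germs $f,g:(\mathbb{R}^{m},0)\to(\mathbb{R}^{p},0)$ are topologically equivalent if there is a germ of homeomorphism $\phi:(\mathbb{R}^m,0)\to(\mathbb{R}^m,0)$ with $g=f\circ\phi^{-1}$, and bi-Lipschitz equivalent if moreover $\phi$ can be chosen with $\phi$ and $\phi^{-1}$ Lipschitz. A Lipschitz class is an equivalence class for bi-Lipschitz equivalence. *)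

theory Defs
  imports "HOL-Analysis.Analysis"
begin

text \<open>
  A map germ at the origin is given by a representative \<open>f :: 'a \<Rightarrow> 'b\<close>; the equivalences below
  only depend on the values of \<open>f\<close> near \<open>0\<close>. A germ of homeomorphism \<open>('a, 0) \<rightarrow> ('a, 0)\<close> is given by
  a homeomorphism \<open>\<phi>\<close>, with inverse \<open>\<psi>\<close>, between open neighbourhoods \<open>U\<close> and \<open>V\<close> of \<open>0\<close>.
\<close>

definition homeomorphism_germ ::
    "'a::euclidean_space set \<Rightarrow> 'a set \<Rightarrow> ('a \<Rightarrow> 'a) \<Rightarrow> ('a \<Rightarrow> 'a) \<Rightarrow> bool"
  where "homeomorphism_germ U V \<phi> \<psi> \<longleftrightarrow>
    open U \<and> 0 \<in> U \<and> open V \<and> 0 \<in> V \<and> homeomorphism U V \<phi> \<psi> \<and> \<phi> 0 = 0"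

text \<open>
  There is no change of coordinates in the target. Asking for \<open>g = f \<circ> \<psi>\<close> (and for the Lipschitz
  bounds) on all of \<open>U\<close> and \<open>V\<close> is no restriction, as both may be shrunk.
\<close>

definition topologically_equivalent ::
    "('a::euclidean_space \<Rightarrow> 'b::euclidean_space) \<Rightarrow> ('a \<Rightarrow> 'b) \<Rightarrow> bool"
  where "topologically_equivalent f g \<longleftrightarrow>
    (\<exists>U V \<phi> \<psi>. homeomorphism_germ U V \<phi> \<psi> \<and> (\<forall>y\<in>V. g y = f (\<psi> y)))"

definition bilipschitz_equivalent ::
    "('a::euclidean_space \<Rightarrow> 'b::euclidean_space) \<Rightarrow> ('a \<Rightarrow> 'b) \<Rightarrow> bool"
  where "bilipschitz_equivalent f g \<longleftrightarrow>
    (\<exists>U V \<phi> \<psi>. homeomorphism_germ U V \<phi> \<psi> \<and> (\<forall>y\<in>V. g y = f (\<psi> y)) \<and>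
      (\<exists>C. C-lipschitz_on U \<phi>) \<and> (\<exists>D. D-lipschitz_on V \<psi>))"

definition mixed_germ :: "nat ^ 'n \<Rightarrow> nat ^ 'n \<Rightarrow> complex ^ 'n::finite \<Rightarrow> complex"
  where "mixed_germ a b z = (\<Sum>i\<in>UNIV. (z $ i) ^ (a $ i + b $ i) * cnj (z $ i) ^ (b $ i))"

text \<open>
  The exponents \<open>b\<close> may be \<open>0\<close>; the side condition \<open>mixed_germ a b 0 = 0\<close> excludes those \<open>b\<close> with
  \<open>a $ i = b $ i = 0\<close> for some \<open>i\<close>.
\<close>

definition mixed_germ_family :: "nat ^ 'n \<Rightarrow> (complex ^ 'n::finite \<Rightarrow> complex) set"
  where "mixed_germ_family a = {mixed_germ a b |b. mixed_germ a b 0 = 0}"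

end

theory Submission
  imports Defs
begin

text \<open>
  In polar form \<open>z ^ (a + b) * cnj z ^ b\<close> has modulus \<open>norm z ^ (a + 2 * b)\<close> and the direction of
  \<open>z ^ a\<close>. For fixed \<open>a\<close> the exponents \<open>b\<close> are therefore visible only in the moduli, and a
  coordinatewise reparametrisation of the moduli by powers, which is a homeomorphism of the whole
  space, carries any member of the family to any other
  (\<open>topologically_equivalent_mixed_germs\<close>). Hence the entire family is topologically trivial.

  A bi-Lipschitz change of coordinates distorts the distance to the origin only by bounded factors,
  so it preserves the order of vanishing at the origin
  (\<open>vanishes_to_order_bilipschitz_equivalent\<close>). That order is the least of the numbers
  \<open>a $ i + 2 * b $ i\<close> (\<open>vanishes_to_order_mixed_germ_iff\<close>). If all \<open>b $ i\<close> equal one number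
  \<open>c\<close>, it is \<open>2 * c\<close> plus the least \<open>a $ i\<close>, so different \<open>c\<close> yield different Lipschitz classes.
\<close>

section \<open>Topological equivalence by reparametrising moduli\<close>

definition radial_power :: "real \<Rightarrow> 'a::real_normed_vector \<Rightarrow> 'a"
  where "radial_power s z = (norm z powr s) *\<^sub>R sgn z"

lemma norm_radial_power: "norm (radial_power s z) = norm z powr s"
  by (simp add: radial_power_def norm_sgn)

lemma sgn_radial_power: "sgn (radial_power s z) = sgn z"
  by (simp add: radial_power_def sgn_scaleR sgn_div_norm[of "sgn z"] norm_sgn)

lemma radial_power_radial_power: "radial_power s (radial_power t z) = radial_power (t * s) z"
  unfolding radial_power_def[of s] norm_radial_power sgn_radial_power
  by (simp add: radial_power_def powr_powr)

lemma radial_power_one: "radial_power 1 z = z"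
  by (cases "z = 0") (simp_all add: radial_power_def sgn_div_norm)

lemma isCont_radial_power:
  assumes "s > 0"
  shows "isCont (radial_power s) z"
proof (cases "z = 0")
  case True
  have "((\<lambda>x::'a. norm x powr s) \<longlongrightarrow> norm (0::'a) powr s) (at 0)"
    using assms by (intro tendsto_powr' tendsto_norm tendsto_ident_at tendsto_const) auto
  then have "((\<lambda>x::'a. norm (radial_power s x)) \<longlongrightarrow> 0) (at 0)"
    by (simp add: norm_radial_power)
  then have "((\<lambda>x::'a. radial_power s x) \<longlongrightarrow> 0) (at 0)"
    by (rule tendsto_norm_zero_cancel)
  then show ?thesis
    using True by (simp add: isCont_def radial_power_def[of s 0])
next
  case False
  then show ?thesis
    unfolding radial_power_def[abs_def] sgn_div_norm by (intro continuous_intros) auto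
qed

lemma mixed_monomial_polar:
  fixes z :: complex
  shows "z ^ (a + b) * cnj z ^ b = of_real (norm z ^ (a + 2 * b)) * sgn z ^ a"
proof (cases "z = 0")
  case True
  then show ?thesis by (simp add: power_0_left)
next
  case False
  have "z ^ (a + b) * cnj z ^ b = z ^ a * (z * cnj z) ^ b"
    by (simp add: power_add power_mult_distrib mult.assoc)
  also have "\<dots> = (of_real (norm z) * sgn z) ^ a * of_real (norm z ^ (2 * b))"
    using False
    by (simp add: complex_norm_square[symmetric] power_mult sgn_eq)
  finally show ?thesis
    by (simp add: power_add power_mult_distrib mult_ac)
qed

lemma mixed_germ_zero_iff:
  fixes a b :: "nat ^ 'n::finite"
  shows "mixed_germ a b 0 = 0 \<longleftrightarrow> (\<forall>i. a $ i + 2 * b $ i > 0)"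
proof -
  have "mixed_germ a b 0 = of_nat (\<Sum>i\<in>UNIV. 0 ^ (a $ i + b $ i) * 0 ^ (b $ i))"
    by (simp add: mixed_germ_def)
  then have "mixed_germ a b 0 = 0 \<longleftrightarrow> (\<Sum>i\<in>UNIV. 0 ^ (a $ i + b $ i) * 0 ^ (b $ i)) = (0::nat)"
    using of_nat_eq_0_iff by metis
  also have "\<dots> \<longleftrightarrow> (\<forall>i. a $ i + 2 * b $ i > 0)"
    by (auto simp: power_0_left simp flip: neq0_conv)
  finally show ?thesis .
qed

lemma topologically_equivalent_mixed_germs:
  fixes a b b' :: "nat ^ 'n::finite"
  assumes "mixed_germ a b 0 = 0" and "mixed_germ a b' 0 = 0"
  shows "topologically_equivalent (mixed_germ a b) (mixed_germ a b')"
proof -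
  define d where "d i = a $ i + 2 * b $ i" for i
  define d' where "d' i = a $ i + 2 * b' $ i" for i
  have pos: "d i > 0" "d' i > 0" for i
    using assms by (simp_all add: mixed_germ_zero_iff d_def d'_def)
  define \<phi> \<psi> :: "complex ^ 'n \<Rightarrow> complex ^ 'n"
    where "\<phi> x = (\<chi> i. radial_power (d i / d' i) (x $ i))"
      and "\<psi> x = (\<chi> i. radial_power (d' i / d i) (x $ i))" for x
  have "continuous_on UNIV \<phi>" "continuous_on UNIV \<psi>"
    unfolding \<phi>_def \<psi>_def using pos
    by (auto intro!: continuous_at_imp_continuous_on continuous_on_vec_lambda
        isCont_o2[OF _ isCont_radial_power] continuous_intros)
  moreover have "\<psi> (\<phi> x) = x" "\<phi> (\<psi> x) = x" for x
    by (simp_all add: \<phi>_def \<psi>_def vec_eq_iff radial_power_radial_power radial_power_one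
        pos[THEN gr_implies_not0])
  ultimately have "homeomorphism UNIV UNIV \<phi> \<psi>"
    by (simp add: homeomorphismI)
  moreover have "\<phi> 0 = 0"
    by (simp add: \<phi>_def vec_eq_iff radial_power_def)
  ultimately have "homeomorphism_germ UNIV UNIV \<phi> \<psi>"
    by (simp add: homeomorphism_germ_def)
  moreover have "mixed_germ a b' y = mixed_germ a b (\<psi> y)" for y
  proof -
    have "(norm z powr (d' i / d i)) ^ d i = norm z ^ d' i" for i and z :: complex
      using pos[of i] by (cases "z = 0")
        (simp_all add: powr_realpow[symmetric] powr_powr power_0_left)
    then show ?thesis
      unfolding mixed_germ_def
      by (intro sum.cong refl)
        (simp add: mixed_monomial_polar \<psi>_def norm_radial_power sgn_radial_power
          flip: d_def d'_def)
  qed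
  ultimately show ?thesis
    unfolding topologically_equivalent_def by blast
qed

section \<open>The order of vanishing as a bi-Lipschitz invariant\<close>

definition vanishes_to_order ::
    "nat \<Rightarrow> ('a::real_normed_vector \<Rightarrow> 'b::real_normed_vector) \<Rightarrow> bool"
  where "vanishes_to_order m f \<longleftrightarrow>
    (\<exists>C. \<forall>\<^sub>F x in nhds 0. norm (f x) \<le> C * norm x ^ m)"

lemma bilipschitz_equivalent_sym:
  assumes "bilipschitz_equivalent f g"
  shows "bilipschitz_equivalent g f"
proof -
  obtain U V \<phi> \<psi> C D where hom: "homeomorphism_germ U V \<phi> \<psi>" and fg: "\<forall>y\<in>V. g y = f (\<psi> y)"
    and lip: "C-lipschitz_on U \<phi>" "D-lipschitz_on V \<psi>"
    using assms unfolding bilipschitz_equivalent_def by blast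
  have \<psi>\<phi>: "\<psi> (\<phi> x) = x" "\<phi> x \<in> V" if "x \<in> U" for x
    using hom that by (auto simp: homeomorphism_germ_def homeomorphism_def)
  moreover have "\<psi> 0 = 0"
    using hom \<psi>\<phi>(1)[of 0] by (simp add: homeomorphism_germ_def)
  then have "homeomorphism_germ V U \<psi> \<phi>"
    using hom by (simp add: homeomorphism_germ_def homeomorphism_symD)
  moreover have "\<forall>x\<in>U. f x = g (\<phi> x)"
    using fg \<psi>\<phi> by simp
  ultimately show ?thesis
    unfolding bilipschitz_equivalent_def using lip by blast
qed

text \<open>
  Writing \<open>g = f \<circ> \<psi>\<close>, the bound for \<open>f\<close> at \<open>\<psi> y\<close> becomes one for \<open>g\<close> at \<open>y\<close> because
  \<open>norm (\<psi> y) \<le> D * norm y\<close> when \<open>\<psi>\<close> is \<open>D\<close>-Lipschitz and fixes the origin.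
\<close>

lemma vanishes_to_order_bilipschitz_equivalent:
  assumes "bilipschitz_equivalent f g" and "vanishes_to_order m f"
  shows "vanishes_to_order m g"
proof -
  obtain U V \<phi> \<psi> D where hom: "homeomorphism_germ U V \<phi> \<psi>" and fg: "\<forall>y\<in>V. g y = f (\<psi> y)"
    and lip: "D-lipschitz_on V \<psi>"
    using assms(1) unfolding bilipschitz_equivalent_def by blast
  obtain C where C: "\<forall>\<^sub>F x in nhds 0. norm (f x) \<le> C * norm x ^ m"
    using assms(2) unfolding vanishes_to_order_def by blast
  have V: "open V" "0 \<in> V"
    using hom by (simp_all add: homeomorphism_germ_def)
  have \<psi>0: "\<psi> 0 = 0"
    using hom homeomorphism_apply1[of U V \<phi> \<psi> 0] by (simp add: homeomorphism_germ_def)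
  have "isCont \<psi> 0"
    using lipschitz_on_continuous_on[OF lip] V continuous_on_eq_continuous_at by blast
  then have "filterlim \<psi> (nhds 0) (nhds 0)"
    using \<psi>0 by (simp add: isCont_def tendsto_nhds_iff)
  then have "\<forall>\<^sub>F y in nhds 0. norm (f (\<psi> y)) \<le> C * norm (\<psi> y) ^ m"
    by (rule eventually_compose_filterlim[OF C])
  moreover have "\<forall>\<^sub>F y in nhds 0. y \<in> V"
    using V by (rule eventually_nhds_in_open)
  ultimately have "\<forall>\<^sub>F y in nhds 0. norm (g y) \<le> (\<bar>C\<bar> * D ^ m) * norm y ^ m"
  proof eventually_elim
    case (elim y)
    have "norm (\<psi> y) \<le> D * norm y"
      using lipschitz_onD[OF lip elim(2) V(2)] by (simp add: \<psi>0)
    then have "norm (\<psi> y) ^ m \<le> (D * norm y) ^ m"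
      by (intro power_mono) auto
    then have "C * norm (\<psi> y) ^ m \<le> \<bar>C\<bar> * (D * norm y) ^ m"
      by (intro mult_mono) auto
    then show ?case
      using elim fg by (simp add: power_mult_distrib mult.assoc)
  qed
  then show ?thesis
    unfolding vanishes_to_order_def by blast
qed

text \<open>
  Near the origin each monomial is at most \<open>norm z ^ m\<close> when its degree is at least \<open>m\<close>; conversely,
  on the \<open>i\<close>-th coordinate axis the germ is the single monomial of degree \<open>a $ i + 2 * b $ i\<close>,
  provided that all the others vanish at the origin.
\<close>

lemma vanishes_to_order_mixed_germ_iff:
  fixes a b :: "nat ^ 'n::finite"
  assumes "mixed_germ a b 0 = 0"
  shows "vanishes_to_order m (mixed_germ a b) \<longleftrightarrow> (\<forall>i. m \<le> a $ i + 2 * b $ i)"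
proof
  assume le: "\<forall>i. m \<le> a $ i + 2 * b $ i"
  have "norm (mixed_germ a b z) \<le> CARD('n) * norm z ^ m" if "norm z < 1" for z
  proof -
    have "norm ((z $ i) ^ (a $ i + b $ i) * cnj (z $ i) ^ (b $ i)) \<le> norm z ^ m" for i
    proof -
      have "norm ((z $ i) ^ (a $ i + b $ i) * cnj (z $ i) ^ (b $ i))
          = norm (z $ i) ^ (a $ i + 2 * b $ i)"
        by (simp add: norm_mult norm_power mult_2 add.assoc power_add)
      also have "\<dots> \<le> norm z ^ (a $ i + 2 * b $ i)"
        using dist_vec_nth_le[of z i 0] by (intro power_mono) simp_all
      also have "\<dots> \<le> norm z ^ m"
        using le that by (intro power_decreasing) auto
      finally show ?thesis .
    qed
    then show ?thesis
      unfolding mixed_germ_def by (intro sum_norm_bound) auto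
  qed
  moreover have "\<forall>\<^sub>F z in nhds (0::complex ^ 'n). norm z < 1"
    using eventually_nhds_metric[of _ "0::complex ^ 'n"] by (auto intro: exI[of _ 1])
  ultimately show "vanishes_to_order m (mixed_germ a b)"
    unfolding vanishes_to_order_def by (blast intro: eventually_mono)
next
  assume "vanishes_to_order m (mixed_germ a b)"
  then obtain C where C: "\<forall>\<^sub>F z in nhds 0. norm (mixed_germ a b z) \<le> C * norm z ^ m"
    unfolding vanishes_to_order_def by blast
  show "\<forall>i. m \<le> a $ i + 2 * b $ i"
  proof (intro allI leI notI)
    fix i
    define d where "d = a $ i + 2 * b $ i"
    assume "a $ i + 2 * b $ i < m"
    then have "d < m" by (simp add: d_def)
    define p :: "real \<Rightarrow> complex ^ 'n" where "p t = axis i (of_real t)" for t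
    have germ_p: "norm (mixed_germ a b (p t)) = t ^ d" if "t > 0" for t
    proof -
      have "mixed_germ a b (p t)
          = (\<Sum>j\<in>UNIV. if j = i then of_real (t ^ d) else 0)"
        unfolding mixed_germ_def
      proof (intro sum.cong refl)
        fix j
        have "a $ j + b $ j = 0 \<longrightarrow> b $ j \<noteq> 0"
          using assms[unfolded mixed_germ_zero_iff, rule_format, of j] by auto
        then show "(p t $ j) ^ (a $ j + b $ j) * cnj (p t $ j) ^ (b $ j)
            = (if j = i then of_real (t ^ d) else 0)"
          by (auto simp: p_def axis_def power_0_left d_def mult_2 add.assoc power_add)
      qed
      then show ?thesis
        using that by (simp add: norm_power)
    qed
    have norm_p: "norm (p t) = \<bar>t\<bar>" for t
      by (simp add: p_def norm_eq_sqrt_inner inner_axis_axis inner_complex_def)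
    have "(p \<longlongrightarrow> 0) (at_right 0)"
      by (rule tendsto_norm_zero_cancel) (auto simp: norm_p intro!: tendsto_eq_intros)
    then have "\<forall>\<^sub>F t in at_right 0. norm (mixed_germ a b (p t)) \<le> C * norm (p t) ^ m"
      by (rule eventually_compose_filterlim[OF C])
    moreover have "\<forall>\<^sub>F t in at_right 0. t > (0::real)"
      by (rule eventually_at_right_less)
    ultimately have "\<forall>\<^sub>F t in at_right 0. 1 \<le> C * t ^ (m - d)"
    proof eventually_elim
      case (elim t)
      have "t ^ m = t ^ d * t ^ (m - d)"
        using \<open>d < m\<close> by (simp flip: power_add)
      then have "t ^ d * 1 \<le> t ^ d * (C * t ^ (m - d))"
        using elim by (simp add: germ_p norm_p mult_ac)
      then show ?case
        using elim(2) by (rule mult_left_le_imp_le[OF _ zero_less_power])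
    qed
    moreover have "((\<lambda>t::real. C * t ^ (m - d)) \<longlongrightarrow> 0) (at_right 0)"
      using \<open>d < m\<close> by (auto intro!: tendsto_eq_intros)
    ultimately have "(1::real) \<le> 0"
      by (intro tendsto_le[OF _ _ tendsto_const]) auto
    then show False by simp
  qed
qed

section \<open>Infinitely many Lipschitz classes\<close>

theorem proposition5p1:
  fixes a :: "nat ^ 'n::{finite,linorder}"
  assumes "\<And>i j. i \<le> j \<Longrightarrow> a $ i \<le> a $ j"
    and "\<exists>j. a $ j \<ge> 1"
  shows "\<exists>S \<subseteq> mixed_germ_family a.
    (\<forall>f\<in>S. \<forall>g\<in>S. topologically_equivalent f g) \<and>
    (\<exists>T \<subseteq> S. infinite T \<and> (\<forall>f\<in>T. \<forall>g\<in>T. f \<noteq> g \<longrightarrow> \<not> bilipschitz_equivalent f g))"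
proof -
  \<comment> \<open>The shift to \<open>Suc c\<close> makes every monomial vanish at the origin, even when \<open>a $ i = 0\<close>.\<close>
  define F where "F c = mixed_germ a (\<chi> i. Suc c)" for c
  have F0: "F c 0 = 0" for c
    by (simp add: F_def mixed_germ_zero_iff)
  define k where "k = (MIN i. a $ i)"
  have order: "vanishes_to_order m (F c) \<longleftrightarrow> m \<le> k + 2 * Suc c" for m c
  proof -
    have "k \<in> range (($) a)" and min: "k \<le> a $ i" for i
      unfolding k_def by (intro Min_in) (auto intro: Min_le)
    then obtain j where "k = a $ j" by blast
    then have "(\<forall>i. m \<le> a $ i + 2 * Suc c) \<longleftrightarrow> m \<le> k + 2 * Suc c"
      using min by (auto elim: order_trans)
    then show ?thesis
      using vanishes_to_order_mixed_germ_iff[OF F0[unfolded F_def]] by (simp add: F_def)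
  qed
  have le: "c \<le> c'" if "bilipschitz_equivalent (F c) (F c')" for c c'
    using vanishes_to_order_bilipschitz_equivalent[OF that, of "k + 2 * Suc c"]
    by (simp add: order)
  have inequiv: "c = c'" if "bilipschitz_equivalent (F c) (F c')" for c c'
    using le[OF that] le[OF bilipschitz_equivalent_sym[OF that]] by simp
  have "inj F"
  proof (rule injI)
    fix c c' assume "F c = F c'"
    then have "m \<le> k + 2 * Suc c \<longleftrightarrow> m \<le> k + 2 * Suc c'" for m
      by (metis order)
    from this[of "k + 2 * Suc c"] this[of "k + 2 * Suc c'"] show "c = c'" by simp
  qed
  then have "infinite (range F)"
    by (simp add: range_inj_infinite)
  moreover have "range F \<subseteq> mixed_germ_family a"
    using F0 by (auto simp: mixed_germ_family_def F_def)
  moreover have "\<forall>f\<in>range F. \<forall>g\<in>range F. f \<noteq> g \<longrightarrow> \<not> bilipschitz_equivalent f g"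
    using inequiv by auto
  moreover have "\<forall>f\<in>mixed_germ_family a. \<forall>g\<in>mixed_germ_family a. topologically_equivalent f g"
    by (auto simp: mixed_germ_family_def intro: topologically_equivalent_mixed_germs)
  ultimately show ?thesis by blast
qed

end
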